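(* If $m\in\{2,3,4\}$ then $T^{(4)}_m = T^{(3,2)}_m$. In particular, for every positive integer $m\le 4$ the additive group of $\mathbb{Z}\langle X_m\rangle/T^{(4)}_m$ is free abelian.
   Context: $\mathbb{Z}\langle X\rangle$ is the free unitary associative ring freely generated by the infinite countable set $X=\{x_1,x_2,\dots\}$. Commutators are left-normed: $[a,b]=ab-ba$ and $[a_1,\dots,a_n]=[[a_1,\dots,a_{n-1}],a_n]$. $T^{(4)}$ is the two-sided ideal of $\mathbb{Z}\langle X\rangle$ generated by all commutators $[a_1,a_2,a_3,a_4]$ with $a_i\in\mathbb{Z}\langle X\rangle$. $T^{(3,2)}$ is the two-sided ideal of $\mathbb{Z}\langle X\rangle$ generated by all elements $[a_1,a_2,a_3,a_4]$ and $[a_1,a_2,a_3][a_4,a_5]$ with $a_i\in\mathbb{Z}\langle X\rangle$. For a positive integer $m$, $X_m=\{x_1,\dots,x_m\}\subset X$, so that $\mathbb{Z}\langle X_m\rangle\subset\mathbb{Z}\langle X\rangle$, and $T^{(4)}_m=\mathbb{Z}\langle X_m\rangle\cap T^{(4)}$, $T^{(3,2)}_m=\mathbb{Z}\langle X_m\rangle\cap T^{(3,2)}$. *)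

theory Defs
  imports
    "HOL-Library.Poly_Mapping"
    "HOL-Algebra.Free_Abelian_Groups"
    "HOL-Algebra.QuotRing"
    "HOL-Algebra.Subrings"
    "HOL-Algebra.Algebraic_Closure_Type"
begin

section \<open>The free unitary associative ring on countably many generators\<close>

text \<open>
  The ring of noncommutative integer polynomials is the monoid ring over the integers of the free
  monoid of words. Words are wrapped lists whose monoid operation is written additively, so that
  the convolution product of \<^theory>\<open>HOL-Library.Poly_Mapping\<close> is the product of the free ring.
  The generator called \<open>x\<^sub>i\<close> (for \<open>i \<ge> 1\<close>) in the mathematical text is the letter \<open>i - 1\<close> here.
\<close>

datatype word = Word (letters: "nat list")

instantiation word :: monoid_add
begin

definition zero_word :: word where "0 = Word []"

definition plus_word :: "word \<Rightarrow> word \<Rightarrow> word" where "u + v = Word (letters u @ letters v)"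

instance
  by standard (simp_all add: zero_word_def plus_word_def)

end

type_synonym free_ring = "word \<Rightarrow>\<^sub>0 int"

definition var :: "nat \<Rightarrow> free_ring" where
  "var i = Poly_Mapping.single (Word [i]) 1"

abbreviation ZX :: "free_ring ring" where
  "ZX \<equiv> ring_of_type_algebra"

lemma ring_ZX: "ring ZX"
proof -
  have "\<exists>y. x + y = 0" for x :: free_ring
    using add.right_inverse by blast
  thus ?thesis
    unfolding ring_of_type_algebra_def using add.right_inverse
    by unfold_locales (auto simp: algebra_simps Units_def)
qed

definition words_below :: "nat \<Rightarrow> word set" where
  "words_below m = {w. set (letters w) \<subseteq> {..<m}}"

text \<open>The subring of polynomials in the first \<open>m\<close> generators.\<close>

definition ZX_upto :: "nat \<Rightarrow> free_ring ring" where
  "ZX_upto m = ZX\<lparr>carrier := {f. Poly_Mapping.keys f \<subseteq> words_below m}\<rparr>"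

lemma var_in_ZX_upto: "var i \<in> carrier (ZX_upto m) \<longleftrightarrow> i < m"
  by (simp add: var_def ZX_upto_def words_below_def)

lemma subring_ZX_upto: "subring (carrier (ZX_upto m)) ZX"
proof -
  interpret ring ZX by (rule ring_ZX)
  have uminus: "\<ominus>\<^bsub>ZX\<^esub> f = - f" for f
    by (rule minus_equality) (simp_all add: ring_of_type_algebra_def)
  show ?thesis
  proof (rule subringI)
    fix f g assume fg: "f \<in> carrier (ZX_upto m)" "g \<in> carrier (ZX_upto m)"
    have "Poly_Mapping.keys (f * g) \<subseteq> words_below m"
      using fg keys_mult[of f g] by (fastforce simp: ZX_upto_def words_below_def plus_word_def)
    thus "f \<otimes>\<^bsub>ZX\<^esub> g \<in> carrier (ZX_upto m)"
      by (simp add: ZX_upto_def ring_of_type_algebra_def)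
    show "f \<oplus>\<^bsub>ZX\<^esub> g \<in> carrier (ZX_upto m)"
      using fg Poly_Mapping.keys_add[of f g] by (auto simp: ZX_upto_def ring_of_type_algebra_def)
    show "\<ominus>\<^bsub>ZX\<^esub> f \<in> carrier (ZX_upto m)"
      using fg unfolding uminus by (simp add: ZX_upto_def)
  qed (auto simp: ZX_upto_def words_below_def zero_word_def ring_of_type_algebra_def)
qed


section \<open>The ideals generated by commutators\<close>

definition commutator :: "free_ring \<Rightarrow> free_ring \<Rightarrow> free_ring" where
  "commutator a b = a * b - b * a"

text \<open>Left-normed commutators; \<open>lcomm a [b, c, d]\<close> is \<open>[a, b, c, d] = [[[a, b], c], d]\<close>.\<close>

definition lcomm :: "free_ring \<Rightarrow> free_ring list \<Rightarrow> free_ring" where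
  "lcomm a bs = foldl commutator a bs"

text \<open>
  In a noncommutative ring, \<^const>\<open>genideal\<close> is the \<^emph>\<open>two-sided\<close> ideal generated by a set.
  The arguments of the commutators range over all polynomials in all generators.
\<close>

definition T4 :: "free_ring set" where
  "T4 = genideal ZX {lcomm a1 [a2, a3, a4] |a1 a2 a3 a4. True}"

definition T32 :: "free_ring set" where
  "T32 = genideal ZX ({lcomm a1 [a2, a3, a4] |a1 a2 a3 a4. True} \<union>
                      {lcomm a1 [a2, a3] * lcomm a4 [a5] |a1 a2 a3 a4 a5. True})"

definition T4_upto :: "nat \<Rightarrow> free_ring set" where
  "T4_upto m = carrier (ZX_upto m) \<inter> T4"

definition T32_upto :: "nat \<Rightarrow> free_ring set" where
  "T32_upto m = carrier (ZX_upto m) \<inter> T32"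

lemma ideal_T4_upto: "ideal (T4_upto m) (ZX_upto m)"
proof -
  interpret ring ZX by (rule ring_ZX)
  interpret T: ideal T4 ZX
    unfolding T4_def by (rule genideal_ideal) (simp add: ring_of_type_algebra_def)
  have eq: "ZX_upto m = ZX\<lparr>carrier := carrier (ZX_upto m)\<rparr>"
    by (simp add: ZX_upto_def)
  have sub: "subring (carrier (ZX_upto m)) ZX"
    by (rule subring_ZX_upto)
  have ring: "ring (ZX_upto m)"
    using subring_is_ring[OF sub] eq by simp
  interpret S: ring "ZX_upto m" by (rule ring)
  have ops: "x \<otimes>\<^bsub>ZX_upto m\<^esub> y = x \<otimes>\<^bsub>ZX\<^esub> y" "x \<oplus>\<^bsub>ZX_upto m\<^esub> y = x \<oplus>\<^bsub>ZX\<^esub> y"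
    "\<zero>\<^bsub>ZX_upto m\<^esub> = \<zero>\<^bsub>ZX\<^esub>" for x y
    by (simp_all add: ZX_upto_def)
  have uminus: "\<ominus>\<^bsub>ZX_upto m\<^esub> x = \<ominus>\<^bsub>ZX\<^esub> x" if "x \<in> carrier (ZX_upto m)" for x
    by (rule sym, rule minus_equality)
      (use S.l_neg[OF that] S.a_inv_closed[OF that] that in
        \<open>simp_all add: ops ring_of_type_algebra_def\<close>)
  show ?thesis
  proof (rule idealI[OF ring])
    show "subgroup (T4_upto m) (add_monoid (ZX_upto m))"
    proof (rule S.add.subgroupI)
      fix a assume "a \<in> T4_upto m"
      thus "\<ominus>\<^bsub>ZX_upto m\<^esub> a \<in> T4_upto m"
        using uminus[of a] S.a_inv_closed[of a] T.a_inv_closed[of a] by (simp add: T4_upto_def)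
    qed (use S.zero_closed T.zero_closed S.a_closed T.a_closed ops in \<open>auto simp: T4_upto_def\<close>)
  qed (use S.m_closed T.I_l_closed T.I_r_closed ops in
        \<open>auto simp: T4_upto_def ring_of_type_algebra_def\<close>)
qed


section \<open>Free abelian groups\<close>

text \<open>
  Restricting the index set \<open>S\<close> to the type of the group elements loses no generality, since a
  basis of a group is a subset of its carrier set.
\<close>

definition free_abelian :: "('a, 'b) monoid_scheme \<Rightarrow> bool" where
  "free_abelian G \<longleftrightarrow> (\<exists>S :: 'a set. G \<cong> free_Abelian_group S)"

end

theory Submission
  imports Defs
begin

text \<open>
  Let \<open>T\<close> be an ideal that contains all commutators of length four, so that modulo \<open>T\<close> every triple
  commutator \<open>[a, b, c]\<close> is central. Expanding \<open>[a, b, c d, e]\<close> and \<open>[a d, b, c, e]\<close> by the Leibniz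
  rule shows that the product \<open>W = [a, b, c] [d, e]\<close> changes its sign modulo \<open>T\<close> under every
  transposition of its five arguments (\<open>W_swap34_sum\<close>, \<open>W_swap13_sum\<close>). As \<open>W\<close> contains the
  literal factor \<open>[d, e]\<close>, it vanishes modulo \<open>T\<close> as soon as two arguments agree; so it vanishes on
  variables when there are at most four of them. Modulo \<open>T\<close> it is also a derivation in its last
  argument, hence in each argument, which extends the vanishing from variables to all polynomials in
  these variables (\<open>W_few_generators\<close>). The retraction that kills the other variables then gives
  the equality of the two ideals (\<open>T4_upto_eq_T32_upto\<close>).

  The second claim is proved by a basis of the quotient by \<open>T\<^sup>(\<^sup>3\<^sup>,\<^sup>2\<^sup>)\<close>: the products
  \<open>x\<^sub>s c\<close> of an ordered monomial and a normal form \<open>c\<close> among \<open>1\<close>, \<open>[x\<^sub>i, x\<^sub>j]\<close>, \<open>[x\<^sub>i, x\<^sub>j, x\<^sub>k]\<close> and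
  \<open>[x\<^sub>i, x\<^sub>j] [x\<^sub>k, x\<^sub>l]\<close>. They span because exchanging two adjacent letters of a monomial produces a
  commutator that can be moved to the right at the cost of longer commutators, and the process stops
  at triple commutators and at products of two commutators: a product of three commutators of
  variables is alternating modulo \<open>T\<^sup>(\<^sup>3\<^sup>,\<^sup>2\<^sup>)\<close> and has six arguments, so it vanishes in four variables
  (\<open>basis_spans\<close>).

  For independence (\<open>basis_independent\<close>), the partial derivations preserve \<open>T\<^sup>(\<^sup>3\<^sup>,\<^sup>2\<^sup>)\<close> and kill every
  \<open>c\<close>. Applying the iterated derivation that belongs to a longest monomial \<open>x\<^sub>s\<close> of a relation leaves a
  nonzero multiple of the part \<open>\<Sum>n\<^sub>c c\<close> that goes with \<open>x\<^sub>s\<close>. What remains concerns degrees at most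
  four: \<open>T\<^sup>(\<^sup>3\<^sup>,\<^sup>2\<^sup>)\<close> has no terms of degree below four, and its part of degree four is spanned by Lie
  elements, on which the pairing with a shuffle product of two words of length two vanishes
  (\<open>coord_T32\<close>). These functionals separate the normal forms.
\<close>

notation commutator (\<open>\<langle>_, _\<rangle>\<close>)

section \<open>Permutations by adjacent transpositions\<close>

text \<open>
  Used both for the alternating products of commutators and for sorting the letters of a monomial.
\<close>

lemma adjacent_swaps_perm:
  assumes swap: "\<And>us x y vs. P (us @ x # y # vs) \<Longrightarrow> P (us @ y # x # vs)"
    and "mset xs = mset ys" "P xs"
  shows "P ys"
proof -
  have move: "P (us @ x # ps @ qs)" if "P (us @ ps @ x # qs)" for us ps qs and x :: 'a
    using that
  proof (induction ps arbitrary: us)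
    case (Cons p ps)
    have "P ((us @ [p]) @ x # ps @ qs)" by (rule Cons.IH) (use Cons.prems in simp)
    then show ?case using swap[of us p x "ps @ qs"] by simp
  qed simp
  have "P (us @ ys)" if "P (us @ xs)" for us
    using assms(2) that
  proof (induction ys arbitrary: us xs)
    case (Cons y ys)
    then have "y \<in> set xs" by (metis list.set_intros(1) mset_eq_setD)
    then obtain ps qs where xs: "xs = ps @ y # qs" by (meson split_list)
    then have "mset (ps @ qs) = mset ys" using Cons.prems(1) by simp
    moreover have "P ((us @ [y]) @ ps @ qs)" using move[of us ps y qs] Cons.prems(2) xs by simp
    ultimately have "P ((us @ [y]) @ ys)" by (rule Cons.IH)
    then show ?case by simp
  qed simp
  from this[of "[]"] show ?thesis using assms(3) by simp
qed

lemma adjacent_swaps_repeated: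
  assumes swap: "\<And>us x y vs. P (us @ x # y # vs) \<Longrightarrow> P (us @ y # x # vs)"
    and twice: "\<And>us x. P (us @ [x, x])"
    and "\<not> distinct xs"
  shows "P xs"
proof -
  obtain ps qs rs x where xs: "xs = ps @ [x] @ qs @ [x] @ rs"
    using not_distinct_decomp[OF assms(3)] by blast
  show ?thesis
    by (rule adjacent_swaps_perm[where P = P, OF swap _ twice[of "ps @ qs @ rs" x]])
      (simp_all add: xs)
qed

lemma not_distinct_below:
  fixes xs :: "nat list"
  assumes "set xs \<subseteq> {..<n}" "length xs > n"
  shows "\<not> distinct xs"
  using assms card_mono[of "{..<n}" "set xs"] distinct_card[of xs] by fastforce


section \<open>Two-sided ideals\<close>

text \<open>
  Ideals of the ring type itself, so that the ring operations are those of the type class and the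
  automation for noncommutative rings applies.
\<close>

locale two_sided_ideal =
  fixes T :: "free_ring set"
  assumes zero: "0 \<in> T"
    and add: "x \<in> T \<Longrightarrow> y \<in> T \<Longrightarrow> x + y \<in> T"
    and left: "x \<in> T \<Longrightarrow> p * x \<in> T"
    and right: "x \<in> T \<Longrightarrow> x * p \<in> T"
begin

lemma uminus: "x \<in> T \<Longrightarrow> - x \<in> T"
  using left[of x "- 1"] by simp

lemma diff: "x \<in> T \<Longrightarrow> y \<in> T \<Longrightarrow> x - y \<in> T"
  using add[of x "- y"] uminus[of y] by simp

lemma add_mem_iff: "x + y \<in> T \<Longrightarrow> x \<in> T \<longleftrightarrow> y \<in> T"
  using diff[of "x + y" x] diff[of "x + y" y] by auto

lemma ideal: "ideal T ZX"
proof -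
  interpret R: ring ZX by (rule ring_ZX)
  have [simp]: "\<ominus>\<^bsub>ZX\<^esub> f = - f" for f
    by (rule R.minus_equality) (simp_all add: ring_of_type_algebra_def)
  show ?thesis
  proof (rule idealI[OF ring_ZX])
    show "subgroup T (add_monoid ZX)"
    proof (rule R.add.subgroupI)
      fix a assume "a \<in> T"
      then have "- a \<in> T" by (rule uminus)
      then show "\<ominus>\<^bsub>ZX\<^esub> a \<in> T" by simp
    qed (use zero add in \<open>auto simp: ring_of_type_algebra_def\<close>)
  qed (use left right in \<open>auto simp: ring_of_type_algebra_def\<close>)
qed

lemma genideal_subset: "S \<subseteq> T \<Longrightarrow> genideal ZX S \<subseteq> T"
  using ring.genideal_minimal[OF ring_ZX ideal] .

end

lemma two_sided_ideal_genideal: "two_sided_ideal (genideal ZX S)"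
proof -
  interpret R: ring ZX by (rule ring_ZX)
  interpret I: ideal "genideal ZX S" ZX
    by (rule R.genideal_ideal) (simp add: ring_of_type_algebra_def)
  show ?thesis
    using I.zero_closed I.a_closed I.I_l_closed I.I_r_closed
    by unfold_locales (auto simp: ring_of_type_algebra_def)
qed

lemma genideal_superset: "S \<subseteq> genideal ZX S"
  using ring.genideal_self[OF ring_ZX, of S] by (simp add: ring_of_type_algebra_def)

lemma comm_swap: "\<langle>b, a\<rangle> = - \<langle>a, b\<rangle>"
  and comm_self: "\<langle>a, a\<rangle> = 0"
  and comm_zero: "\<langle>0, a\<rangle> = 0" "\<langle>a, 0\<rangle> = 0"
  and comm_one: "\<langle>1, a\<rangle> = 0" "\<langle>a, 1\<rangle> = 0"
  and comm_minus: "\<langle>- a, b\<rangle> = - \<langle>a, b\<rangle>" "\<langle>a, - b\<rangle> = - \<langle>a, b\<rangle>"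
  and comm_diff: "\<langle>a - a', b\<rangle> = \<langle>a, b\<rangle> - \<langle>a', b\<rangle>" "\<langle>a, b - b'\<rangle> = \<langle>a, b\<rangle> - \<langle>a, b'\<rangle>"
  and comm_add: "\<langle>a + a', b\<rangle> = \<langle>a, b\<rangle> + \<langle>a', b\<rangle>" "\<langle>a, b + b'\<rangle> = \<langle>a, b\<rangle> + \<langle>a, b'\<rangle>"
  and comm_mult_right: "\<langle>a, b * c\<rangle> = b * \<langle>a, c\<rangle> + \<langle>a, b\<rangle> * c"
  and comm_mult_left: "\<langle>a * b, c\<rangle> = a * \<langle>b, c\<rangle> + \<langle>a, c\<rangle> * b"
  by (simp_all add: commutator_def algebra_simps)

section \<open>Alternation of products of a triple commutator and a commutator\<close>

locale lie4_ideal = two_sided_ideal +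
  assumes comm4: "\<langle>\<langle>\<langle>a, b\<rangle>, c\<rangle>, d\<rangle> \<in> T"
begin

abbreviation W where "W a b c d e \<equiv> \<langle>\<langle>a, b\<rangle>, c\<rangle> * \<langle>d, e\<rangle>"

text \<open>
  The Leibniz rule for \<open>[a, b, c d]\<close>, followed by the commutator with \<open>e\<close>: the terms in which \<open>e\<close>
  meets a triple commutator lie in \<open>T\<close>, and the other two are the products in question.
\<close>

lemma W_swap34_sum: "W a b c d e + W a b d c e \<in> T"
proof -
  have "W a b c d e + W a b d c e = \<langle>\<langle>\<langle>a, b\<rangle>, c * d\<rangle>, e\<rangle> - c * \<langle>\<langle>\<langle>a, b\<rangle>, d\<rangle>, e\<rangle>
      - \<langle>\<langle>\<langle>a, b\<rangle>, c\<rangle>, e\<rangle> * d + \<langle>\<langle>\<langle>a, b\<rangle>, d\<rangle>, \<langle>c, e\<rangle>\<rangle>"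
    by (simp add: commutator_def algebra_simps)
  also have "\<dots> \<in> T" by (intro add diff left right comm4)
  finally show ?thesis .
qed

lemma W_swap35_sum: "W a b c d e + W a b e d c \<in> T"
proof -
  have "W a b c d e + W a b e d c
      = (W a b c d e + W a b d c e) - (- (W a b e d c + W a b d e c))"
    using comm_swap[of c e] by (simp add: algebra_simps)
  then show ?thesis by (metis W_swap34_sum diff uminus)
qed

text \<open>
  Expanding \<open>[a d, b, c, e]\<close> gives six products of a triple commutator and a commutator. Four of
  them cancel in pairs by the alternation in the last three arguments; the other two remain.
\<close>

lemma W_swap13_sum: "W a c d e b + W d c a e b \<in> T"
proof -
  define r where "r = \<langle>\<langle>\<langle>a * d, b\<rangle>, c\<rangle>, e\<rangle> - a * \<langle>\<langle>\<langle>d, b\<rangle>, c\<rangle>, e\<rangle> - \<langle>\<langle>\<langle>a, b\<rangle>, c\<rangle>, e\<rangle> * d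
     + \<langle>\<langle>\<langle>d, b\<rangle>, c\<rangle>, \<langle>a, e\<rangle>\<rangle> + \<langle>\<langle>\<langle>d, b\<rangle>, e\<rangle>, \<langle>a, c\<rangle>\<rangle> + \<langle>\<langle>\<langle>d, c\<rangle>, e\<rangle>, \<langle>a, b\<rangle>\<rangle>"
  have r: "r \<in> T" unfolding r_def by (intro add diff left right comm4)
  \<comment> \<open>The last three summands of \<open>r\<close> move the triple commutators to the left.\<close>
  have "r = (W d b c a e + W d b e a c) + (W a b e d c + W a b c d e) + (W a c e d b + W d c e a b)"
    unfolding r_def by (simp add: commutator_def algebra_simps)
  then have "W a c e d b + W d c e a b \<in> T"
    using diff[OF diff[OF r W_swap35_sum[of d b c a e]] W_swap35_sum[of a b e d c]]
    by (simp add: algebra_simps)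
  moreover have "W a c d e b + W d c a e b = (W a c e d b + W a c d e b) + (W d c e a b + W d c a e b)
     - (W a c e d b + W d c e a b)"
    by (simp add: algebra_simps)
  ultimately show ?thesis by (metis W_swap34_sum add diff)
qed

lemma W_swap12: "W a b c d e \<in> T \<longleftrightarrow> W b a c d e \<in> T"
  by (rule add_mem_iff) (simp add: comm_swap[of a b] comm_minus zero)

lemma W_swap34: "W a b c d e \<in> T \<longleftrightarrow> W a b d c e \<in> T"
  by (rule add_mem_iff) (rule W_swap34_sum)

lemma W_swap45: "W a b c d e \<in> T \<longleftrightarrow> W a b c e d \<in> T"
  by (rule add_mem_iff) (simp add: comm_swap[of d e] zero)

lemma W_swap23: "W a b c d e \<in> T \<longleftrightarrow> W a c b d e \<in> T"
proof -
  have "W b a c d e \<in> T \<longleftrightarrow> W c a b d e \<in> T"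
    by (rule add_mem_iff) (rule W_swap13_sum)
  then show ?thesis using W_swap12 by blast
qed

text \<open>
  Moves the last argument to the front, so that a statement about the last argument can be applied
  to all five in turn.
\<close>

lemma W_rotate: "W a b c d e \<in> T \<longleftrightarrow> W e a b c d \<in> T"
  by (rule trans[OF W_swap45 trans[OF W_swap34 trans[OF W_swap23 W_swap12]]])

lemma W_repeated:
  assumes "\<not> distinct [a, b, c, d, e]"
  shows "W (var a) (var b) (var c) (var d) (var e) \<in> T"
proof -
  define P where "P xs \<longleftrightarrow> (\<forall>a b c d e. xs = [a, b, c, d, e] \<longrightarrow>
    W (var a) (var b) (var c) (var d) (var e) \<in> T)" for xs
  have "P [a, b, c, d, e]"
  proof (rule adjacent_swaps_repeated[where P = P, OF _ _ assms])
    show "P (us @ y # x # vs)" if "P (us @ x # y # vs)" for us x y vs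
      unfolding P_def
    proof (intro allI impI)
      fix a b c d e assume eq: "us @ y # x # vs = [a, b, c, d, e]"
      then consider "us = []" | "\<exists>p. us = [p]" | "\<exists>p q. us = [p, q]" | "\<exists>p q r. us = [p, q, r]"
        by (auto simp: append_eq_Cons_conv)
      then show "W (var a) (var b) (var c) (var d) (var e) \<in> T"
        using that eq W_swap12 W_swap23 W_swap34 W_swap45 by cases (auto simp: P_def)
    qed
    show "P (us @ [x, x])" for us x
      by (auto simp: P_def append_eq_Cons_conv comm_self zero)
  qed
  then show ?thesis by (simp add: P_def)
qed

end

section \<open>Monomials\<close>

abbreviation mon :: "nat list \<Rightarrow> free_ring" where
  "mon w \<equiv> frag_of (Word w)"

lemma mon_Nil: "mon [] = 1"
  by (simp add: zero_word_def[symmetric])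

lemma mon_append: "mon (u @ v) = mon u * mon v"
  by (simp add: mult_single plus_word_def)

lemma mon_Cons: "mon (i # w) = var i * mon w"
  using mon_append[of "[i]" w] by (simp add: var_def)

lemma free_ring_induct [case_names zero mon diff]:
  fixes f :: free_ring
  assumes "P 0" and mon: "\<And>w. P (mon w)" and "\<And>f g. P f \<Longrightarrow> P g \<Longrightarrow> P (f - g)"
  shows "P f"
proof (rule frag_induction[of f UNIV])
  show "P (frag_of x)" for x
    using mon[of "letters x"] by simp
qed (use assms in auto)

lemma ZX_upto_induct [consumes 1, case_names zero mon diff]:
  assumes f: "f \<in> carrier (ZX_upto m)"
    and "P 0" and mon: "\<And>w. set w \<subseteq> {..<m} \<Longrightarrow> P (mon w)"
    and "\<And>f g. P f \<Longrightarrow> P g \<Longrightarrow> P (f - g)"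
  shows "P f"
proof (rule frag_induction[of f "words_below m"])
  show "Poly_Mapping.keys f \<subseteq> words_below m" using f by (simp add: ZX_upto_def)
  show "P (frag_of x)" if "x \<in> words_below m" for x
    using mon[of "letters x"] that by (simp add: words_below_def)
qed (use assms in auto)

lemma frag_extend_mult:
  fixes f g :: free_ring and h :: "word \<Rightarrow> free_ring"
  assumes "\<And>u v. h (u + v) = h u * h v"
  shows "frag_extend h (f * g) = frag_extend h f * frag_extend h g"
proof (induction f rule: free_ring_induct)
  case (mon u)
  show ?case
    by (induction g rule: free_ring_induct)
      (simp_all add: right_diff_distrib frag_extend_diff mult_single assms)
qed (simp_all add: left_diff_distrib frag_extend_diff)

section \<open>Equality of the two ideals in at most four generators\<close>

context lie4_ideal
begin

text \<open>
  Modulo \<open>T\<close> the factor \<open>[a, b, c]\<close> is central, so \<open>W\<close> inherits the Leibniz rule of \<open>[d, -]\<close>.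
\<close>

lemma W_last_mult:
  assumes "W a b c d e \<in> T" "W a b c d f \<in> T"
  shows "W a b c d (e * f) \<in> T"
proof -
  have "W a b c d (e * f) = e * W a b c d f + W a b c d e * f + \<langle>\<langle>\<langle>a, b\<rangle>, c\<rangle>, e\<rangle> * \<langle>d, f\<rangle>"
    by (simp add: commutator_def algebra_simps)
  then show ?thesis using assms by (simp add: add left right comm4)
qed

lemma W_last_extend:
  assumes "f \<in> carrier (ZX_upto m)" and var: "\<And>i. i < m \<Longrightarrow> W a b c d (var i) \<in> T"
  shows "W a b c d f \<in> T"
  using assms(1)
proof (induction rule: ZX_upto_induct)
  case (mon w)
  then show ?case
    by (induction w) (auto simp: mon_Nil mon_Cons comm_one zero intro: W_last_mult var)
qed (simp_all add: comm_zero comm_diff right_diff_distrib zero diff)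

text \<open>
  On variables two of the five arguments coincide. Each step of the proof replaces the variable in
  the last position by an arbitrary polynomial and rotates it away.
\<close>

lemma W_few_generators:
  assumes "m \<le> 4" "a \<in> carrier (ZX_upto m)" "b \<in> carrier (ZX_upto m)" "c \<in> carrier (ZX_upto m)"
    "d \<in> carrier (ZX_upto m)" "e \<in> carrier (ZX_upto m)"
  shows "W a b c d e \<in> T"
proof -
  have "W (var i) (var j) (var k) (var l) (var p) \<in> T"
    if "i < m" "j < m" "k < m" "l < m" "p < m" for i j k l p
    by (rule W_repeated, rule not_distinct_below[of _ m]) (use that assms(1) in auto)
  then have "W (var i) (var j) (var k) (var l) a \<in> T" if "i < m" "j < m" "k < m" "l < m" for i j k l
    using W_last_extend assms(2) that by blast
  then have "W a (var i) (var j) (var k) b \<in> T" if "i < m" "j < m" "k < m" for i j k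
    using W_last_extend[OF assms(3)] that W_rotate by blast
  then have "W b a (var i) (var j) c \<in> T" if "i < m" "j < m" for i j
    using W_last_extend[OF assms(4)] that W_rotate by blast
  then have "W c b a (var i) d \<in> T" if "i < m" for i
    using W_last_extend[OF assms(5)] that W_rotate by blast
  then have "W d c b a e \<in> T"
    using W_last_extend[OF assms(6)] W_rotate by blast
  then show ?thesis
    using W_rotate W_swap12 W_swap23 W_swap34 W_swap45 by metis
qed

end

locale lie32_ideal = lie4_ideal +
  assumes comm32: "\<langle>\<langle>a, b\<rangle>, c\<rangle> * \<langle>d, e\<rangle> \<in> T"

lemma lcomm_simps:
  "lcomm a [] = a" "lcomm a (b # bs) = lcomm (\<langle>a, b\<rangle>) bs"
  by (simp_all add: lcomm_def)

lemma lie4_ideal_T4: "lie4_ideal T4"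
proof -
  interpret two_sided_ideal T4 unfolding T4_def by (rule two_sided_ideal_genideal)
  show ?thesis
    using genideal_superset[of "{lcomm a1 [a2, a3, a4] |a1 a2 a3 a4. True}"]
    by unfold_locales (unfold T4_def lcomm_simps, blast)
qed

lemma lie32_ideal_T32: "lie32_ideal T32"
proof -
  interpret two_sided_ideal T32 unfolding T32_def by (rule two_sided_ideal_genideal)
  show ?thesis
    using genideal_superset[of "{lcomm a1 [a2, a3, a4] |a1 a2 a3 a4. True} \<union>
      {lcomm a1 [a2, a3] * lcomm a4 [a5] |a1 a2 a3 a4 a5. True}"]
    by unfold_locales (unfold T32_def lcomm_simps, blast+)
qed

interpretation T4: lie4_ideal T4 by (rule lie4_ideal_T4)
interpretation T32: lie32_ideal T32 by (rule lie32_ideal_T32)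

lemma (in two_sided_ideal) T32_subset:
  assumes "\<And>a b c d. \<langle>\<langle>\<langle>a, b\<rangle>, c\<rangle>, d\<rangle> \<in> T" "\<And>a b c d e. \<langle>\<langle>a, b\<rangle>, c\<rangle> * \<langle>d, e\<rangle> \<in> T"
  shows "T32 \<subseteq> T"
  unfolding T32_def by (rule genideal_subset) (auto simp: lcomm_simps assms)

lemma T4_subset_T32: "T4 \<subseteq> T32"
  unfolding T4_def by (rule T32.genideal_subset) (auto simp: lcomm_simps T32.comm4)

text \<open>
  The ring endomorphism that sends \<open>x\<^sub>i\<close> to \<open>0\<close> for the variables outside the first \<open>m\<close>. It reduces
  membership in an ideal of the whole ring to commutators of polynomials in the first \<open>m\<close>
  variables.
\<close>

definition retract :: "nat \<Rightarrow> free_ring \<Rightarrow> free_ring" where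
  "retract m = frag_extend (\<lambda>w. if w \<in> words_below m then frag_of w else 0)"

lemma retract_mult: "retract m (f * g) = retract m f * retract m g"
  unfolding retract_def
  by (rule frag_extend_mult) (auto simp: words_below_def plus_word_def mult_single)

lemma retract_zero: "retract m 0 = 0"
  and retract_add: "retract m (f + g) = retract m f + retract m g"
  and retract_diff: "retract m (f - g) = retract m f - retract m g"
  by (simp_all add: retract_def frag_extend_diff frag_extend_add)

lemma retract_commutator: "retract m (\<langle>f, g\<rangle>) = \<langle>retract m f, retract m g\<rangle>"
  by (simp add: commutator_def retract_diff retract_mult)

lemma retract_in_ZX_upto: "retract m f \<in> carrier (ZX_upto m)"
  using keys_frag_extend[of "\<lambda>w. if w \<in> words_below m then frag_of w else 0" f]
  by (auto simp: retract_def ZX_upto_def split: if_splits)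

lemma retract_ident: "f \<in> carrier (ZX_upto m) \<Longrightarrow> retract m f = f"
  by (induction rule: ZX_upto_induct) (simp_all add: retract_def frag_extend_diff words_below_def)

lemma T4_upto_eq_T32_upto:
  assumes "m \<le> 4"
  shows "T4_upto m = T32_upto m"
proof -
  interpret J: two_sided_ideal "{f. retract m f \<in> T4}"
    by unfold_locales
      (auto simp: retract_zero retract_add retract_mult T4.left T4.right T4.zero T4.add)
  have "T32 \<subseteq> {f. retract m f \<in> T4}"
    by (rule J.T32_subset)
      (auto simp: retract_mult retract_commutator T4.comm4
        intro: T4.W_few_generators[OF assms] retract_in_ZX_upto)
  then show ?thesis
    using T4_subset_T32 retract_ident by (force simp: T4_upto_def T32_upto_def)
qed

section \<open>Normal forms span the quotient\<close>

text \<open>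
  Codes for the products of commutators that occur in normal forms. Codes are used as indices because
  independence of a family says more than independence of the set of its values.
\<close>

datatype proper = One | Two nat nat | Three nat nat nat | Four nat nat nat nat

fun pval :: "proper \<Rightarrow> free_ring" where
  "pval One = 1"
| "pval (Two i j) = \<langle>var i, var j\<rangle>"
| "pval (Three i j k) = \<langle>\<langle>var i, var j\<rangle>, var k\<rangle>"
| "pval (Four i j k l) = \<langle>var i, var j\<rangle> * \<langle>var k, var l\<rangle>"

text \<open>
  For triples this is the Hall condition: the skew symmetry in the first two arguments and the Jacobi
  identity reduce every triple to such ones. The pairs in a product of two commutators commute modulo
  the ideal, whence the lexicographic condition.
\<close>

fun normal :: "proper \<Rightarrow> bool" where
  "normal One \<longleftrightarrow> True"
| "normal (Two i j) \<longleftrightarrow> i < j"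
| "normal (Three i j k) \<longleftrightarrow> j < i \<and> j \<le> k"
| "normal (Four i j k l) \<longleftrightarrow> i < j \<and> k < l \<and> (i < k \<or> i = k \<and> j \<le> l)"

fun indices :: "proper \<Rightarrow> nat set" where
  "indices One = {}"
| "indices (Two i j) = {i, j}"
| "indices (Three i j k) = {i, j, k}"
| "indices (Four i j k l) = {i, j, k, l}"

definition basis_index :: "nat \<Rightarrow> (nat list \<times> proper) set" where
  "basis_index m = {(s, c). sorted s \<and> set s \<subseteq> {..<m} \<and> normal c \<and> indices c \<subseteq> {..<m}}"

definition basis_elem :: "nat list \<times> proper \<Rightarrow> free_ring" where
  "basis_elem = (\<lambda>(s, c). mon s * pval c)"

context lie32_ideal
begin

abbreviation V where "V a b c d e f \<equiv> \<langle>a, b\<rangle> * \<langle>c, d\<rangle> * \<langle>e, f\<rangle>"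

lemma comm_comm: "\<langle>\<langle>a, b\<rangle>, \<langle>c, d\<rangle>\<rangle> \<in> T"
proof -
  have "\<langle>\<langle>a, b\<rangle>, \<langle>c, d\<rangle>\<rangle> = \<langle>\<langle>\<langle>a, b\<rangle>, c\<rangle>, d\<rangle> - \<langle>\<langle>\<langle>a, b\<rangle>, d\<rangle>, c\<rangle>"
    by (simp add: commutator_def algebra_simps)
  then show ?thesis by (simp add: diff comm4)
qed

lemma pair_times_triple: "\<langle>a, b\<rangle> * \<langle>\<langle>c, d\<rangle>, e\<rangle> \<in> T"
proof -
  have "\<langle>a, b\<rangle> * \<langle>\<langle>c, d\<rangle>, e\<rangle> = W c d e a b - \<langle>\<langle>\<langle>c, d\<rangle>, e\<rangle>, \<langle>a, b\<rangle>\<rangle>"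
    by (simp add: commutator_def)
  then show ?thesis by (simp add: diff comm4 comm32)
qed

text \<open>
  The Leibniz expansion of \<open>[a, b c, d]\<close> contains \<open>[b, d] [a, c]\<close> and \<open>[a, b] [c, d]\<close>, besides terms with
  a triple commutator as a factor. A further factor \<open>[e, f]\<close> removes the latter and \<open>[a, b c, d]\<close>.
\<close>

lemma V_swap23_sum: "V a b c d e f + V a c b d e f \<in> T"
proof -
  have "V a b c d e f + V a c b d e f = W a (b * c) d e f - b * W a c d e f
      - (c * W a b d e f + \<langle>\<langle>\<langle>a, b\<rangle>, d\<rangle>, c\<rangle> * \<langle>e, f\<rangle>) - \<langle>\<langle>b, d\<rangle>, \<langle>a, c\<rangle>\<rangle> * \<langle>e, f\<rangle>"
    by (simp add: commutator_def algebra_simps)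
  also have "\<dots> \<in> T" by (intro add diff left right comm32 comm4 comm_comm)
  finally show ?thesis .
qed

lemma V_swap45_sum: "V a b c d e f + V a b c e d f \<in> T"
proof -
  have "V a b c d e f + V a b c e d f = \<langle>a, b\<rangle> * \<langle>\<langle>c, d * e\<rangle>, f\<rangle>
      - (d * (\<langle>a, b\<rangle> * \<langle>\<langle>c, e\<rangle>, f\<rangle>) + \<langle>\<langle>a, b\<rangle>, d\<rangle> * \<langle>\<langle>c, e\<rangle>, f\<rangle>)
      - (\<langle>a, b\<rangle> * \<langle>\<langle>c, d\<rangle>, f\<rangle>) * e - \<langle>a, b\<rangle> * \<langle>\<langle>d, f\<rangle>, \<langle>c, e\<rangle>\<rangle>"
    by (simp add: commutator_def algebra_simps)
  also have "\<dots> \<in> T" by (intro add diff left[OF pair_times_triple] left[OF comm_comm] pair_times_triple comm32 right)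
  finally show ?thesis .
qed

lemma V_swap12: "V a b c d e f \<in> T \<longleftrightarrow> V b a c d e f \<in> T"
  by (rule add_mem_iff) (simp add: comm_swap[of a b] zero)

lemma V_swap23: "V a b c d e f \<in> T \<longleftrightarrow> V a c b d e f \<in> T"
  by (rule add_mem_iff) (rule V_swap23_sum)

lemma V_swap34: "V a b c d e f \<in> T \<longleftrightarrow> V a b d c e f \<in> T"
  by (rule add_mem_iff) (simp add: comm_swap[of c d] zero)

lemma V_swap45: "V a b c d e f \<in> T \<longleftrightarrow> V a b c e d f \<in> T"
  by (rule add_mem_iff) (rule V_swap45_sum)

lemma V_swap56: "V a b c d e f \<in> T \<longleftrightarrow> V a b c d f e \<in> T"
  by (rule add_mem_iff) (simp add: comm_swap[of e f] zero)

lemma V_repeated: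
  assumes "\<not> distinct [a, b, c, d, e, f]"
  shows "V (var a) (var b) (var c) (var d) (var e) (var f) \<in> T"
proof -
  define P where "P xs \<longleftrightarrow> (\<forall>a b c d e f. xs = [a, b, c, d, e, f] \<longrightarrow>
    V (var a) (var b) (var c) (var d) (var e) (var f) \<in> T)" for xs
  have "P [a, b, c, d, e, f]"
  proof (rule adjacent_swaps_repeated[where P = P, OF _ _ assms])
    show "P (us @ y # x # vs)" if "P (us @ x # y # vs)" for us x y vs
      unfolding P_def
    proof (intro allI impI)
      fix a b c d e f assume eq: "us @ y # x # vs = [a, b, c, d, e, f]"
      then consider "us = []" | "\<exists>p. us = [p]" | "\<exists>p q. us = [p, q]" | "\<exists>p q r. us = [p, q, r]"
        | "\<exists>p q r s. us = [p, q, r, s]"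
        by (auto simp: append_eq_Cons_conv)
      then show "V (var a) (var b) (var c) (var d) (var e) (var f) \<in> T"
        using that eq V_swap12 V_swap23 V_swap34 V_swap45 V_swap56 by cases (auto simp: P_def)
    qed
    show "P (us @ [x, x])" for us x
      by (auto simp: P_def append_eq_Cons_conv comm_self zero)
  qed
  then show ?thesis by (simp add: P_def)
qed

end

text \<open>
  Four variables cannot fill the six arguments of a product of three commutators without repetition.
  This is where the normal forms of products of commutators end.
\<close>

locale lie32_few = lie32_ideal +
  fixes m :: nat
  assumes m_le: "m \<le> 4"
begin

lemma V_few_generators:
  "i < m \<Longrightarrow> j < m \<Longrightarrow> k < m \<Longrightarrow> l < m \<Longrightarrow> p < m \<Longrightarrow> q < m \<Longrightarrow>
    V (var i) (var j) (var k) (var l) (var p) (var q) \<in> T"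
  by (rule V_repeated, rule not_distinct_below[of _ m]) (use m_le in auto)

definition basis_span :: "free_ring set" where
  "basis_span = {f. \<exists>x. Poly_Mapping.keys x \<subseteq> basis_index m \<and> f - frag_extend basis_elem x \<in> T}"

lemma span_T: "f \<in> T \<Longrightarrow> f \<in> basis_span"
  unfolding basis_span_def by (auto intro!: exI[of _ 0])

lemma span_diff:
  assumes "f \<in> basis_span" "g \<in> basis_span"
  shows "f - g \<in> basis_span"
proof -
  obtain x y where "Poly_Mapping.keys x \<subseteq> basis_index m" "f - frag_extend basis_elem x \<in> T"
    "Poly_Mapping.keys y \<subseteq> basis_index m" "g - frag_extend basis_elem y \<in> T"
    using assms by (auto simp: basis_span_def)
  then have "Poly_Mapping.keys (x - y) \<subseteq> basis_index m \<and> f - g - frag_extend basis_elem (x - y) \<in> T"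
    using diff[of "f - frag_extend basis_elem x" "g - frag_extend basis_elem y"] keys_diff[of x y]
    by (auto simp: frag_extend_diff algebra_simps)
  then show ?thesis by (auto simp: basis_span_def)
qed

lemma span_zero: "0 \<in> basis_span"
  by (rule span_T) (rule zero)

lemma span_uminus: "f \<in> basis_span \<Longrightarrow> - f \<in> basis_span"
  using span_diff[OF span_zero, of f] by simp

lemma span_add: "f \<in> basis_span \<Longrightarrow> g \<in> basis_span \<Longrightarrow> f + g \<in> basis_span"
  using span_diff[of f "- g"] span_uminus[of g] by simp

lemma span_basis:
  assumes "sorted s" "set s \<subseteq> {..<m}" "normal c" "indices c \<subseteq> {..<m}"
  shows "mon s * pval c \<in> basis_span"
  using assms unfolding basis_span_def
  by (intro CollectI exI[of _ "frag_of (s, c)"])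
    (simp add: basis_elem_def basis_index_def zero)

text \<open>
  A right factor \<open>c\<close> can be carried along while a monomial is sorted, provided that the commutators
  which the exchanges of letters create are already known to be in the span.
\<close>

lemma span_sort:
  assumes swap: "\<And>us x y vs. set us \<subseteq> {..<m} \<Longrightarrow> x < m \<Longrightarrow> y < m \<Longrightarrow> set vs \<subseteq> {..<m} \<Longrightarrow>
      mon us * \<langle>var x, var y\<rangle> * mon vs * c \<in> basis_span"
    and sorted: "\<And>s. sorted s \<Longrightarrow> set s \<subseteq> {..<m} \<Longrightarrow> mon s * c \<in> basis_span"
    and "set w \<subseteq> {..<m}"
  shows "mon w * c \<in> basis_span"
proof -
  define P where "P w \<longleftrightarrow> (set w \<subseteq> {..<m} \<longrightarrow> mon w * c \<in> basis_span)" for w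
  have "P w"
  proof (rule adjacent_swaps_perm[of P "sort w"])
    show "P (us @ y # x # vs)" if "P (us @ x # y # vs)" for us x y vs
      unfolding P_def
    proof
      assume vars: "set (us @ y # x # vs) \<subseteq> {..<m}"
      have "mon (us @ y # x # vs) * c = mon (us @ x # y # vs) * c
          - mon us * \<langle>var x, var y\<rangle> * mon vs * c"
        by (simp add: mon_append mon_Cons commutator_def algebra_simps)
      also have "\<dots> \<in> basis_span"
        using that vars by (intro span_diff swap) (auto simp: P_def)
      finally show "mon (us @ y # x # vs) * c \<in> basis_span" .
    qed
    show "P (sort w)" using sorted[of "sort w"] by (simp add: P_def)
  qed simp
  then show ?thesis using assms(3) by (simp add: P_def)
qed

text \<open>
  The Jacobi identity in the form \<open>[x\<^sub>i, x\<^sub>j, x\<^sub>k] = [x\<^sub>i, x\<^sub>k, x\<^sub>j] - [x\<^sub>j, x\<^sub>k, x\<^sub>i]\<close> handles the case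
  \<open>k < j < i\<close>.
\<close>

lemma span_triple_sorted:
  assumes s: "sorted s" "set s \<subseteq> {..<m}" and "i < m" "j < m" "k < m"
  shows "mon s * pval (Three i j k) \<in> basis_span"
proof -
  have desc: "mon s * pval (Three i j k) \<in> basis_span" if "j < i" "i < m" "k < m" for i j k
  proof (cases "j \<le> k")
    case True
    then show ?thesis using that by (intro span_basis s) auto
  next
    case False
    have "mon s * pval (Three i j k) = mon s * pval (Three i k j) - mon s * pval (Three j k i)"
      by (simp add: commutator_def algebra_simps)
    also have "\<dots> \<in> basis_span"
      using that False by (intro span_diff span_basis s) auto
    finally show ?thesis .
  qed
  consider "j < i" | "i < j" | "i = j" by linarith
  then show ?thesis
  proof cases
    case 2
    then show ?thesis using span_uminus[OF desc[of i j k]] assms(3-)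
      by (simp add: comm_swap[of "var i" "var j"] comm_minus)
  qed (use desc assms in \<open>auto simp: comm_self comm_zero span_zero\<close>)
qed

lemma span_pair_sorted:
  assumes s: "sorted s" "set s \<subseteq> {..<m}" and "i < m" "j < m"
  shows "mon s * pval (Two i j) \<in> basis_span"
proof -
  consider "j < i" | "i < j" | "i = j" by linarith
  then show ?thesis
  proof cases
    case 1
    then show ?thesis using span_uminus[OF span_basis[OF s, of "Two j i"]] assms(3-)
      by (simp add: comm_swap[of "var i" "var j"])
  next
    case 2
    then show ?thesis using assms by (intro span_basis s) auto
  qed (simp add: comm_self span_zero)
qed

lemma span_pairs_sorted:
  assumes s: "sorted s" "set s \<subseteq> {..<m}" and "i < m" "j < m" "k < m" "l < m"
  shows "mon s * pval (Four i j k l) \<in> basis_span"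
proof -
  have asc: "mon s * pval (Four i j k l) \<in> basis_span" if "i < j" "k < l" "j < m" "l < m" for i j k l
  proof (cases "i < k \<or> i = k \<and> j \<le> l")
    case True
    then show ?thesis using that by (intro span_basis s) auto
  next
    case False
    have "mon s * pval (Four i j k l)
        = mon s * pval (Four k l i j) + mon s * \<langle>\<langle>var i, var j\<rangle>, \<langle>var k, var l\<rangle>\<rangle>"
      by (simp add: commutator_def algebra_simps)
    also have "\<dots> \<in> basis_span"
      using that False by (intro span_add span_basis s span_T left comm_comm) auto
    finally show ?thesis .
  qed
  have half: "mon s * pval (Four i j k l) \<in> basis_span" if "i < j" "j < m" "k < m" "l < m" for i j k l
  proof -
    consider "l < k" | "k < l" | "k = l" by linarith
    then show ?thesis
    proof cases
      case 1
      then show ?thesis using span_uminus[OF asc[of i j l k]] that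
        by (simp add: comm_swap[of "var l" "var k"])
    qed (use asc that in \<open>auto simp: comm_self span_zero\<close>)
  qed
  consider "j < i" | "i < j" | "i = j" by linarith
  then show ?thesis
  proof cases
    case 1
    then show ?thesis using span_uminus[OF half[of j i k l]] assms(3-)
      by (simp add: comm_swap[of "var j" "var i"])
  qed (use half assms in \<open>auto simp: comm_self span_zero\<close>)
qed

text \<open>
  For the factors of highest weight, triples and products of two pairs, the exchange of two letters
  changes nothing modulo \<open>T\<close>: such a \<open>c\<close> is central and annihilates commutators of variables.
\<close>

lemma span_central:
  assumes central: "\<And>f. \<langle>c, f\<rangle> \<in> T"
    and kill: "\<And>x y. x < m \<Longrightarrow> y < m \<Longrightarrow> \<langle>var x, var y\<rangle> * c \<in> T"
    and sorted: "\<And>s. sorted s \<Longrightarrow> set s \<subseteq> {..<m} \<Longrightarrow> mon s * c \<in> basis_span"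
    and "set w \<subseteq> {..<m}"
  shows "mon w * c \<in> basis_span"
proof (rule span_sort[OF _ sorted assms(4)])
  fix us vs x y assume "x < m" "y < m"
  have "mon us * \<langle>var x, var y\<rangle> * mon vs * c
      = mon us * (\<langle>var x, var y\<rangle> * c) * mon vs - mon us * \<langle>var x, var y\<rangle> * \<langle>c, mon vs\<rangle>"
    by (simp add: commutator_def algebra_simps)
  also have "\<dots> \<in> basis_span"
    using \<open>x < m\<close> \<open>y < m\<close> by (intro span_T diff left[OF central] right left[OF kill])
  finally show "mon us * \<langle>var x, var y\<rangle> * mon vs * c \<in> basis_span" .
qed

lemma span_triple:
  assumes "set w \<subseteq> {..<m}" "i < m" "j < m" "k < m"
  shows "mon w * \<langle>\<langle>var i, var j\<rangle>, var k\<rangle> \<in> basis_span"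
  by (rule span_central)
    (use assms span_triple_sorted[of _ i j k] in \<open>auto intro: comm4 pair_times_triple\<close>)

lemma span_pairs:
  assumes "set w \<subseteq> {..<m}" "i < m" "j < m" "k < m" "l < m"
  shows "mon w * (\<langle>var i, var j\<rangle> * \<langle>var k, var l\<rangle>) \<in> basis_span"
proof (rule span_central)
  show "\<langle>\<langle>var i, var j\<rangle> * \<langle>var k, var l\<rangle>, f\<rangle> \<in> T" for f
    unfolding comm_mult_left by (intro add pair_times_triple comm32)
  show "\<langle>var x, var y\<rangle> * (\<langle>var i, var j\<rangle> * \<langle>var k, var l\<rangle>) \<in> T" if "x < m" "y < m" for x y
    using V_few_generators[of x y i j k l] that assms by (simp add: mult.assoc)
qed (use assms span_pairs_sorted[of _ i j k l] in auto)

lemma span_pair: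
  assumes w: "set w \<subseteq> {..<m}" and ij: "i < m" "j < m"
  shows "mon w * \<langle>var i, var j\<rangle> \<in> basis_span"
proof (rule span_sort[OF _ _ w])
  fix us vs x y assume "set us \<subseteq> {..<m}" "x < m" "y < m" "set vs \<subseteq> {..<m}"
  have "mon us * \<langle>var x, var y\<rangle> * mon vs * \<langle>var i, var j\<rangle>
      = mon (us @ vs) * (\<langle>var x, var y\<rangle> * \<langle>var i, var j\<rangle>)
        + mon us * (\<langle>\<langle>var x, var y\<rangle>, mon vs\<rangle> * \<langle>var i, var j\<rangle>)"
    by (simp add: commutator_def mon_append algebra_simps)
  also have "\<dots> \<in> basis_span"
    by (intro span_add span_pairs span_T left comm32) (use \<open>set us \<subseteq> _\<close> \<open>set vs \<subseteq> _\<close> \<open>x < m\<close> \<open>y < m\<close> ij in auto)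
  finally show "mon us * \<langle>var x, var y\<rangle> * mon vs * \<langle>var i, var j\<rangle> \<in> basis_span" .
qed (use span_pair_sorted[of _ i j] ij in auto)

text \<open>
  A pair cannot be moved past a monomial for free, but the letters of the monomial can be passed one
  by one, and each leaves a central triple behind.
\<close>

lemma span_pair_mon:
  assumes "set w \<subseteq> {..<m}" "set v \<subseteq> {..<m}" "i < m" "j < m"
  shows "mon w * \<langle>\<langle>var i, var j\<rangle>, mon v\<rangle> \<in> basis_span"
  using assms(1,2)
proof (induction v arbitrary: w)
  case (Cons k v)
  have "mon w * \<langle>\<langle>var i, var j\<rangle>, mon (k # v)\<rangle> = mon (w @ [k]) * \<langle>\<langle>var i, var j\<rangle>, mon v\<rangle>
      + mon (w @ v) * \<langle>\<langle>var i, var j\<rangle>, var k\<rangle> + mon w * \<langle>\<langle>\<langle>var i, var j\<rangle>, var k\<rangle>, mon v\<rangle>"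
    by (simp add: mon_Cons mon_append mon_Nil comm_mult_right)
      (simp add: commutator_def algebra_simps)
  also have "\<dots> \<in> basis_span"
    by (intro span_add Cons.IH span_triple span_T left comm4) (use Cons.prems assms(3,4) in auto)
  finally show ?case .
qed (simp add: mon_Nil comm_one span_zero)

lemma span_mon:
  assumes "set w \<subseteq> {..<m}"
  shows "mon w \<in> basis_span"
proof -
  have "mon w * 1 \<in> basis_span"
  proof (rule span_sort[OF _ _ assms])
    fix us vs x y assume "set us \<subseteq> {..<m}" "x < m" "y < m" "set vs \<subseteq> {..<m}"
    have "mon us * \<langle>var x, var y\<rangle> * mon vs * 1
        = mon (us @ vs) * \<langle>var x, var y\<rangle> + mon us * \<langle>\<langle>var x, var y\<rangle>, mon vs\<rangle>"
      by (simp add: commutator_def mon_append algebra_simps)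
    also have "\<dots> \<in> basis_span"
      by (intro span_add span_pair span_pair_mon)
        (use \<open>set us \<subseteq> _\<close> \<open>set vs \<subseteq> _\<close> \<open>x < m\<close> \<open>y < m\<close> in auto)
    finally show "mon us * \<langle>var x, var y\<rangle> * mon vs * 1 \<in> basis_span" .
  qed (use span_basis[of _ One] in auto)
  then show ?thesis by simp
qed

lemma basis_spans:
  assumes "f \<in> carrier (ZX_upto m)"
  obtains x where "Poly_Mapping.keys x \<subseteq> basis_index m" "f - frag_extend basis_elem x \<in> T"
proof -
  have "f \<in> basis_span"
    using assms by (induction rule: ZX_upto_induct) (auto intro: span_zero span_mon span_diff)
  then show ?thesis using that by (auto simp: basis_span_def)
qed

end

section \<open>Partial derivations\<close>

fun mon_deriv :: "nat \<Rightarrow> nat list \<Rightarrow> free_ring" where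
  "mon_deriv i [] = 0"
| "mon_deriv i (a # w) = (if a = i then mon w else 0) + var a * mon_deriv i w"

definition deriv :: "nat \<Rightarrow> free_ring \<Rightarrow> free_ring" where
  "deriv i = frag_extend (\<lambda>w. mon_deriv i (letters w))"

lemma deriv_mon: "deriv i (mon w) = mon_deriv i w"
  by (simp add: deriv_def)

lemma deriv_zero: "deriv i 0 = 0"
  and deriv_add: "deriv i (f + g) = deriv i f + deriv i g"
  and deriv_diff: "deriv i (f - g) = deriv i f - deriv i g"
  and deriv_cmul: "deriv i (frag_cmul n f) = frag_cmul n (deriv i f)"
  by (simp_all add: deriv_def frag_extend_add frag_extend_diff frag_extend_cmul)

lemma mon_deriv_append: "mon_deriv i (u @ v) = mon_deriv i u * mon v + mon u * mon_deriv i v"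
  by (induction u) (simp_all add: mon_Nil mon_Cons mon_append algebra_simps)

lemma deriv_mult: "deriv i (f * g) = deriv i f * g + f * deriv i g"
proof (induction f rule: free_ring_induct)
  case (mon u)
  show ?case
  proof (induction g rule: free_ring_induct)
    case (mon v)
    show ?case by (simp add: mon_append[symmetric] deriv_mon mon_deriv_append)
  qed (simp_all add: deriv_zero deriv_diff algebra_simps)
qed (simp_all add: deriv_zero deriv_diff algebra_simps)

lemma deriv_commutator: "deriv i (\<langle>f, g\<rangle>) = \<langle>deriv i f, g\<rangle> + \<langle>f, deriv i g\<rangle>"
  by (simp add: commutator_def deriv_diff deriv_mult algebra_simps)

lemma deriv_var: "deriv i (var j) = (if i = j then 1 else 0)"
  by (simp add: var_def deriv_mon mon_Nil)

text \<open>
  A derivation maps a product of commutators to a sum of products of the same shape.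
\<close>

lemma deriv_T32: "f \<in> T32 \<Longrightarrow> deriv i f \<in> T32"
proof -
  interpret J: two_sided_ideal "{f \<in> T32. deriv i f \<in> T32}"
    \<comment> \<open>The derivative of a multiple of \<open>f\<close> involves \<open>f\<close> itself, hence the first conjunct.\<close>
    by unfold_locales
      (auto simp: deriv_zero deriv_add deriv_mult T32.zero intro: T32.add T32.left T32.right)
  have "T32 \<subseteq> {f \<in> T32. deriv i f \<in> T32}"
    by (rule J.T32_subset)
      (auto simp: deriv_commutator deriv_mult comm_add distrib_left distrib_right
        intro!: T32.add T32.comm4 T32.comm32)
  then show "f \<in> T32 \<Longrightarrow> deriv i f \<in> T32" by blast
qed

text \<open>
  The derivative of a variable is a constant, which commutes with everything.
\<close>

lemma deriv_pval: "deriv i (pval c) = 0"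
  using deriv_mon[of i "[]"]
  by (cases c) (auto simp: deriv_commutator deriv_mult deriv_var comm_one comm_zero mon_Nil)

fun derivs :: "nat list \<Rightarrow> free_ring \<Rightarrow> free_ring" where
  "derivs [] f = f"
| "derivs (i # s) f = derivs s (deriv i f)"

lemma derivs_zero: "derivs s 0 = 0"
  and derivs_add: "derivs s (f + g) = derivs s f + derivs s g"
  and derivs_cmul: "derivs s (frag_cmul n f) = frag_cmul n (derivs s f)"
  by (induction s arbitrary: f g) (simp_all add: deriv_zero deriv_add deriv_cmul)

lemma derivs_sum: "derivs s (sum f A) = (\<Sum>x\<in>A. derivs s (f x))"
  by (induction A rule: infinite_finite_induct) (simp_all add: derivs_zero derivs_add)

lemma derivs_T32: "f \<in> T32 \<Longrightarrow> derivs s f \<in> T32"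
  by (induction s arbitrary: f) (simp_all add: deriv_T32)

lemma derivs_mult_pval: "derivs s (f * pval c) = derivs s f * pval c"
  by (induction s arbitrary: f) (simp_all add: deriv_mult deriv_pval)

text \<open>
  The product of the factorials of the multiplicities of the letters: the value of \<open>\<partial>\<^sub>s\<close> on each
  rearrangement of the monomial \<open>x\<^sub>s\<close>.
\<close>

fun list_factorial :: "nat list \<Rightarrow> nat" where
  "list_factorial [] = 1"
| "list_factorial (i # s) = Suc (count (mset s) i) * list_factorial s"

lemma list_factorial_pos: "list_factorial s > 0"
  by (induction s) simp_all

lemma derivs_mon:
  assumes "length t \<le> length s"
  shows "derivs s (mon t) = (if mset t = mset s then of_nat (list_factorial s) else 0)"
  using assms
proof (induction s arbitrary: t)
  case (Cons i s)
  \<comment> \<open>The Leibniz rule peels letters off the front of \<open>t\<close>; \<open>u\<close> collects the letters already passed.\<close>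
  have "derivs s (mon u * mon_deriv i v) = (if mset (u @ v) = add_mset i (mset s)
      then of_nat (count (mset v) i * list_factorial s) else 0)"
    if "length (u @ v) \<le> Suc (length s)" for u v
    using that
  proof (induction v arbitrary: u)
    case (Cons a v)
    have "mon u * mon_deriv i (a # v) = (if a = i then mon (u @ v) else 0) + mon (u @ [a]) * mon_deriv i v"
      by (simp add: mon_append mon_Cons mon_Nil algebra_simps)
    then show ?case
      using Cons.IH[of "u @ [a]"] Cons.prems \<open>\<And>t. length t \<le> length s \<Longrightarrow> _ t\<close>[of "u @ v"]
      by (auto simp: derivs_add derivs_zero algebra_simps)
  qed (simp add: derivs_zero)
  from this[of "[]" t] show ?case
    using Cons.prems by (auto simp: deriv_mon mon_Nil)
qed (simp add: mon_Nil)

section \<open>Functionals that vanish on the ideal\<close>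

text \<open>
  The pairing with the shuffle product of the words \<open>i j\<close> and \<open>k l\<close>, whose terms are the six words
  listed here. Shuffle products of nonempty words vanish on Lie elements, in particular on
  commutators of four variables, but not on products of two commutators.
\<close>

definition shuffle_coeff :: "free_ring \<Rightarrow> nat \<Rightarrow> nat \<Rightarrow> nat \<Rightarrow> nat \<Rightarrow> int" where
  "shuffle_coeff f i j k l = (\<Sum>w\<leftarrow>[[i,j,k,l], [i,k,j,l], [i,k,l,j], [k,i,j,l], [k,i,l,j], [k,l,i,j]].
     Poly_Mapping.lookup f (Word w))"

text \<open>
  The word for a triple is \<open>j i k\<close>: it occurs in no other triple in normal form, whereas \<open>i j k\<close>
  also occurs in \<open>[x\<^sub>k, x\<^sub>j, x\<^sub>i]\<close>, which may be in normal form as well.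
\<close>

fun coord :: "proper \<Rightarrow> free_ring \<Rightarrow> int" where
  "coord One f = Poly_Mapping.lookup f (Word [])"
| "coord (Two i j) f = Poly_Mapping.lookup f (Word [i, j])"
| "coord (Three i j k) f = Poly_Mapping.lookup f (Word [j, i, k])"
| "coord (Four i j k l) f = shuffle_coeff f i j k l"

lemma coord_zero: "coord c 0 = 0"
  and coord_add: "coord c (f + g) = coord c f + coord c g"
  and coord_cmul: "coord c (frag_cmul n f) = n * coord c f"
  by (cases c; simp add: shuffle_coeff_def lookup_add algebra_simps)+

lemma coord_sum: "coord c (sum f A) = (\<Sum>x\<in>A. coord c (f x))"
  by (induction A rule: infinite_finite_induct) (simp_all add: coord_zero coord_add)

lemma shuffle_coeff_add: "shuffle_coeff (f + g) i j k l = shuffle_coeff f i j k l + shuffle_coeff g i j k l"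
  and shuffle_coeff_diff: "shuffle_coeff (f - g) i j k l = shuffle_coeff f i j k l - shuffle_coeff g i j k l"
  by (simp_all add: shuffle_coeff_def lookup_add lookup_minus)

text \<open>
  All functionals vanish on this set. Unlike the kernel of a single functional it is an ideal, since
  a nonconstant monomial factor pushes its elements beyond degree four.
\<close>

definition low_kernel :: "free_ring set" where
  "low_kernel = {f. (\<forall>w. length w \<le> 3 \<longrightarrow> Poly_Mapping.lookup f (Word w) = 0) \<and> (\<forall>i j k l. shuffle_coeff f i j k l = 0)}"

lemma lookup_mon_mult:
  "Poly_Mapping.lookup (mon u * f) (Word w) = (if take (length u) w = u then Poly_Mapping.lookup f (Word (drop (length u) w)) else 0)"
proof (induction f rule: free_ring_induct)
  case (mon v)
  show ?case using append_eq_conv_conj[of u v w] by (auto simp: mon_append[symmetric] eq_commute)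
qed (simp_all add: right_diff_distrib lookup_minus)

lemma lookup_mult_mon:
  "Poly_Mapping.lookup (f * mon u) (Word w) = (if length u \<le> length w \<and> drop (length w - length u) w = u
     then Poly_Mapping.lookup f (Word (take (length w - length u) w)) else 0)"
proof (induction f rule: free_ring_induct)
  case (mon v)
  show ?case
    by (auto simp: mon_append[symmetric]) (metis append_take_drop_id)
qed (simp_all add: left_diff_distrib lookup_minus)

lemma low_kernel_zero: "0 \<in> low_kernel"
  and low_kernel_add: "f \<in> low_kernel \<Longrightarrow> g \<in> low_kernel \<Longrightarrow> f + g \<in> low_kernel"
  and low_kernel_diff: "f \<in> low_kernel \<Longrightarrow> g \<in> low_kernel \<Longrightarrow> f - g \<in> low_kernel"
  by (simp_all add: low_kernel_def shuffle_coeff_add shuffle_coeff_diff lookup_add lookup_minus)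
    (simp add: shuffle_coeff_def)

lemma low_kernel_left:
  assumes "f \<in> low_kernel"
  shows "p * f \<in> low_kernel"
proof (induction p rule: free_ring_induct)
  case (mon u)
  show ?case
  proof (cases "u = []")
    case False
    then have "Poly_Mapping.lookup (mon u * f) (Word w) = 0" if "length w \<le> 4" for w
      using assms that by (cases u) (auto simp: low_kernel_def lookup_mon_mult)
    then show ?thesis by (simp add: low_kernel_def shuffle_coeff_def)
  qed (simp add: mon_Nil assms)
qed (simp_all add: left_diff_distrib low_kernel_zero low_kernel_diff)

lemma low_kernel_right:
  assumes "f \<in> low_kernel"
  shows "f * p \<in> low_kernel"
proof (induction p rule: free_ring_induct)
  case (mon u)
  show ?case
  proof (cases "u = []")
    case False
    then have "Poly_Mapping.lookup (f * mon u) (Word w) = 0" if "length w \<le> 4" for w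
      using assms that by (cases u) (auto simp: low_kernel_def lookup_mult_mon)
    then show ?thesis by (simp add: low_kernel_def shuffle_coeff_def)
  qed (simp add: mon_Nil assms)
qed (simp_all add: right_diff_distrib low_kernel_zero low_kernel_diff)

interpretation low_kernel: two_sided_ideal low_kernel
  by unfold_locales (fact low_kernel_zero low_kernel_add low_kernel_left low_kernel_right)+

lemma long_mon_low_kernel: "length w \<ge> 5 \<Longrightarrow> mon w \<in> low_kernel"
  by (auto simp: low_kernel_def shuffle_coeff_def)

text \<open>
  The shuffle pairing of a Lie element, verified as a polynomial identity in the Kronecker symbols
  \<open>e\<close>.
\<close>

lemma comm4_letters_low_kernel: "\<langle>\<langle>\<langle>mon [a], mon [b]\<rangle>, mon [c]\<rangle>, mon [d]\<rangle> \<in> low_kernel"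
proof -
  define e :: "nat \<Rightarrow> nat \<Rightarrow> int" where "e x y = (if x = y then 1 else 0)" for x y
  have expand: "\<langle>\<langle>\<langle>mon [a], mon [b]\<rangle>, mon [c]\<rangle>, mon [d]\<rangle> =
     mon [a,b,c,d] - mon [b,a,c,d] - mon [c,a,b,d] + mon [c,b,a,d]
     - mon [d,a,b,c] + mon [d,b,a,c] + mon [d,c,a,b] - mon [d,c,b,a]"
    by (simp add: commutator_def left_diff_distrib right_diff_distrib mon_append[symmetric])
  have look: "Poly_Mapping.lookup (mon [p,q,r,s]) (Word [i,j,k,l]) = e i p * e j q * e k r * e l s" for p q r s i j k l
    by (auto simp: e_def)
  have "shuffle_coeff (\<langle>\<langle>\<langle>mon [a], mon [b]\<rangle>, mon [c]\<rangle>, mon [d]\<rangle>) i j k l = 0" for i j k l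
    by (simp add: shuffle_coeff_def expand lookup_add lookup_minus look del: lookup_frag_of)
  moreover have "Poly_Mapping.lookup (\<langle>\<langle>\<langle>mon [a], mon [b]\<rangle>, mon [c]\<rangle>, mon [d]\<rangle>) (Word w) = 0" if "length w \<le> 3" for w
  proof -
    have "w \<noteq> [p, q, r, s]" for p q r s using that by auto
    then show ?thesis by (simp add: expand lookup_add lookup_minus)
  qed
  ultimately show ?thesis by (simp add: low_kernel_def)
qed

lemma comm4_mon_low_kernel: "\<langle>\<langle>\<langle>mon a, mon b\<rangle>, mon c\<rangle>, mon d\<rangle> \<in> low_kernel"
proof (cases "a = [] \<or> b = [] \<or> c = [] \<or> d = []")
  case True
  then show ?thesis by (auto simp: mon_Nil comm_one comm_zero low_kernel.zero)
next
  case nonempty: False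
  show ?thesis
  proof (cases "length a + length b + length c + length d \<ge> 5")
    case True
    then show ?thesis
      unfolding commutator_def left_diff_distrib right_diff_distrib mon_append[symmetric]
      by (intro low_kernel.diff long_mon_low_kernel) auto
  next
    case False
    moreover have "length a > 0" "length b > 0" "length c > 0" "length d > 0"
      using nonempty by auto
    ultimately have "length a = 1" "length b = 1" "length c = 1" "length d = 1"
      by linarith+
    then show ?thesis
      by (auto simp: length_Suc_conv intro: comm4_letters_low_kernel)
  qed
qed

lemma comm4_low_kernel: "\<langle>\<langle>\<langle>a, b\<rangle>, c\<rangle>, d\<rangle> \<in> low_kernel"
proof (induction a rule: free_ring_induct)
  case a: (mon a)
  show ?case
  proof (induction b rule: free_ring_induct)
    case b: (mon b)
    show ?case
    proof (induction c rule: free_ring_induct)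
      case c: (mon c)
      show ?case
        by (induction d rule: free_ring_induct)
          (simp_all add: comm_zero comm_diff low_kernel.zero low_kernel.diff comm4_mon_low_kernel)
    qed (simp_all add: comm_zero comm_diff low_kernel.zero low_kernel.diff)
  qed (simp_all add: comm_zero comm_diff low_kernel.zero low_kernel.diff)
qed (simp_all add: comm_zero comm_diff low_kernel.zero low_kernel.diff)

lemma comm32_mon_low_kernel: "\<langle>\<langle>mon a, mon b\<rangle>, mon c\<rangle> * \<langle>mon d, mon e\<rangle> \<in> low_kernel"
proof (cases "a = [] \<or> b = [] \<or> c = [] \<or> d = [] \<or> e = []")
  case True
  then show ?thesis by (auto simp: mon_Nil comm_one comm_zero low_kernel.zero)
next
  case False
  then have "length a \<ge> 1" "length b \<ge> 1" "length c \<ge> 1" "length d \<ge> 1" "length e \<ge> 1"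
    by (auto simp: Suc_le_eq)
  then show ?thesis
    unfolding commutator_def left_diff_distrib right_diff_distrib mon_append[symmetric]
    by (intro low_kernel.diff long_mon_low_kernel) auto
qed

lemma comm32_low_kernel: "\<langle>\<langle>a, b\<rangle>, c\<rangle> * \<langle>d, e\<rangle> \<in> low_kernel"
proof (induction a rule: free_ring_induct)
  case a: (mon a)
  show ?case
  proof (induction b rule: free_ring_induct)
    case b: (mon b)
    show ?case
    proof (induction c rule: free_ring_induct)
      case c: (mon c)
      show ?case
      proof (induction d rule: free_ring_induct)
        case d: (mon d)
        show ?case
          by (induction e rule: free_ring_induct)
            (simp_all add: comm_zero comm_diff right_diff_distrib low_kernel.zero low_kernel.diff
              comm32_mon_low_kernel)
      qed (simp_all add: comm_zero comm_diff right_diff_distrib low_kernel.zero low_kernel.diff)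
    qed (simp_all add: comm_zero comm_diff left_diff_distrib low_kernel.zero low_kernel.diff)
  qed (simp_all add: comm_zero comm_diff left_diff_distrib low_kernel.zero low_kernel.diff)
qed (simp_all add: comm_zero comm_diff left_diff_distrib low_kernel.zero low_kernel.diff)

lemma T32_subset_low_kernel: "T32 \<subseteq> low_kernel"
  by (rule low_kernel.T32_subset) (fact comm4_low_kernel comm32_low_kernel)+

lemma coord_T32: "f \<in> T32 \<Longrightarrow> coord c f = 0"
  using T32_subset_low_kernel by (cases c) (auto simp: low_kernel_def)

lemma pval_expand:
  "pval One = mon []"
  "pval (Two i j) = mon [i, j] - mon [j, i]"
  "pval (Three i j k) = mon [i, j, k] - mon [j, i, k] - mon [k, i, j] + mon [k, j, i]"
  "pval (Four i j k l) = mon [i, j, k, l] - mon [i, j, l, k] - mon [j, i, k, l] + mon [j, i, l, k]"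
  by (simp_all add: mon_Nil var_def commutator_def left_diff_distrib right_diff_distrib
      mon_append[symmetric])

text \<open>
  On a product of two commutators the shuffle pairing is the symmetrized product of the pairings of
  its factors, so the matrix of these functionals on the normal forms is diagonal, with entries \<open>1\<close>
  and \<open>2\<close>.
\<close>

lemma shuffle_coeff_pairs:
  assumes "i < j" "k < l" "i' < j'" "k' < l'"
  shows "shuffle_coeff (pval (Four i' j' k' l')) i j k l
    = of_bool ((i, j) = (i', j') \<and> (k, l) = (k', l')) + of_bool ((k, l) = (i', j') \<and> (i, j) = (k', l'))"
proof -
  define e :: "nat \<Rightarrow> nat \<Rightarrow> int" where "e x y = (if x = y then 1 else 0)" for x y
  define d where "d x y x' y' = e x x' * e y y' - e x y' * e y x'" for x y x' y'
  have look: "Poly_Mapping.lookup (mon [p,q,r,s]) (Word [x,y,z,w]) = e x p * e y q * e z r * e w s"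
    for p q r s x y z w
    by (auto simp: e_def)
  have d: "d x y x' y' = of_bool ((x, y) = (x', y'))" if "x < y" "x' < y'" for x y x' y'
    using that by (auto simp: d_def e_def)
  have "shuffle_coeff (pval (Four i' j' k' l')) i j k l
    = d i j i' j' * d k l k' l' + d k l i' j' * d i j k' l'"
    by (simp add: shuffle_coeff_def pval_expand lookup_add lookup_minus look del: lookup_frag_of pval.simps)
      (simp add: d_def algebra_simps)
  then show ?thesis
    by (simp add: d assms of_bool_conj del: prod.inject)
qed

lemma coord_other:
  assumes "normal c" "normal c'" "c \<noteq> c'"
  shows "coord c (pval c') = 0"
proof (cases c)
  case One
  then show ?thesis using assms
    by (cases c') (simp_all add: pval_expand lookup_add lookup_minus del: pval.simps)
next
  case (Two i j)
  then show ?thesis using assms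
    by (cases c') (auto simp: pval_expand lookup_add lookup_minus simp del: pval.simps)
next
  case (Three i j k)
  then show ?thesis using assms
    by (cases c') (auto simp: pval_expand lookup_add lookup_minus simp del: pval.simps)
next
  case (Four i j k l)
  show ?thesis
  proof (cases c')
    case Four': (Four i' j' k' l')
    have ord: "i < j" "k < l" "i' < j'" "k' < l'" using assms Four Four' by auto
    have "((i, j) = (i', j') \<and> (k, l) = (k', l')) = False"
      "((k, l) = (i', j') \<and> (i, j) = (k', l')) = False"
      using assms Four Four' by auto
    then have "shuffle_coeff (pval (Four i' j' k' l')) i j k l = 0"
      by (simp only: shuffle_coeff_pairs[OF ord] of_bool_eq add_0)
    then show ?thesis by (simp only: Four Four' coord.simps)
  qed (use Four in \<open>simp_all add: shuffle_coeff_def pval_expand lookup_add lookup_minus del: pval.simps\<close>)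
qed

lemma coord_self:
  assumes "normal c"
  shows "coord c (pval c) \<noteq> 0"
proof (cases c)
  case (Four i j k l)
  then show ?thesis using assms by (auto simp: shuffle_coeff_pairs simp del: pval.simps)
qed (use assms in \<open>auto simp: pval_expand lookup_add lookup_minus simp del: pval.simps\<close>)

section \<open>Linear independence of the normal forms\<close>

text \<open>
  With \<open>s\<close> of maximal length in the relation, \<open>\<partial>\<^sub>s\<close> followed by the functional of \<open>c\<close> sends the
  relation to a nonzero multiple of the coefficient at \<open>(s, c)\<close>: shorter monomials are annihilated,
  and so are other sorted monomials of the same length, while the functional of \<open>c\<close> annihilates the
  other normal forms that go with \<open>s\<close>.
\<close>

lemma basis_independent:
  assumes keys: "Poly_Mapping.keys x \<subseteq> basis_index m" and T: "frag_extend basis_elem x \<in> T32"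
  shows "x = 0"
proof (rule ccontr)
  assume "x \<noteq> 0"
  then have "Poly_Mapping.keys x \<noteq> {}" by simp
  then obtain s c where sc: "(s, c) \<in> Poly_Mapping.keys x"
    and max: "\<And>t c'. (t, c') \<in> Poly_Mapping.keys x \<Longrightarrow> length t \<le> length s"
  proof -
    let ?L = "(length \<circ> fst) ` Poly_Mapping.keys x"
    have "Max ?L \<in> ?L" using \<open>Poly_Mapping.keys x \<noteq> {}\<close> by (intro Max_in) auto
    then obtain s c where "(s, c) \<in> Poly_Mapping.keys x" "length s = Max ?L" by force
    moreover have "length t \<le> Max ?L" if "(t, c') \<in> Poly_Mapping.keys x" for t c'
      using that by (intro Max_ge) force+
    ultimately show ?thesis using that by metis
  qed
  have coord_derivs: "coord c (derivs s (basis_elem p))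
      = (if p = (s, c) then int (list_factorial s) * coord c (pval c) else 0)"
    if p: "p \<in> Poly_Mapping.keys x" for p
  proof -
    obtain t c' where tc: "p = (t, c')" by (cases p)
    have norm: "sorted s" "sorted t" "normal c" "normal c'"
      using keys sc p tc by (auto simp: basis_index_def)
    have "mset t = mset s \<longleftrightarrow> t = s"
      using norm by (metis sorted_list_of_multiset_mset sorted_sort_id)
    moreover have "of_nat n * f = frag_cmul (int n) f" for n and f :: free_ring
      by (induction n) (simp_all add: distrib_right frag_cmul_distrib)
    ultimately show ?thesis
      using max[of t c'] p norm coord_other[of c c']
      by (auto simp: tc basis_elem_def derivs_mult_pval derivs_mon coord_zero coord_cmul)
  qed
  have "0 = coord c (derivs s (frag_extend basis_elem x))"
    using T by (simp add: derivs_T32 coord_T32)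
  also have "\<dots> = (\<Sum>p\<in>Poly_Mapping.keys x. Poly_Mapping.lookup x p * coord c (derivs s (basis_elem p)))"
    by (simp add: frag_extend_def derivs_sum coord_sum derivs_cmul coord_cmul)
  also have "\<dots> = (\<Sum>p\<in>Poly_Mapping.keys x. if p = (s, c)
      then Poly_Mapping.lookup x (s, c) * (int (list_factorial s) * coord c (pval c)) else 0)"
    by (rule sum.cong) (auto simp: coord_derivs)
  also have "\<dots> = Poly_Mapping.lookup x (s, c) * (int (list_factorial s) * coord c (pval c))"
    using sc by simp
  also have "\<dots> \<noteq> 0"
    using sc keys coord_self[of c] list_factorial_pos[of s]
    by (auto simp: basis_index_def in_keys_iff)
  finally show False by simp
qed

section \<open>Free abelian quotients\<close>

lemma ZX_upto_add: "f \<in> carrier (ZX_upto m) \<Longrightarrow> g \<in> carrier (ZX_upto m) \<Longrightarrow> f + g \<in> carrier (ZX_upto m)"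
  and ZX_upto_diff: "f \<in> carrier (ZX_upto m) \<Longrightarrow> g \<in> carrier (ZX_upto m) \<Longrightarrow> f - g \<in> carrier (ZX_upto m)"
  using Poly_Mapping.keys_add[of f g] keys_diff[of f g] by (auto simp: ZX_upto_def)

lemma frag_extend_in_ZX_upto:
  assumes "\<And>p. p \<in> B \<Longrightarrow> b p \<in> carrier (ZX_upto m)" "Poly_Mapping.keys x \<subseteq> B"
  shows "frag_extend b x \<in> carrier (ZX_upto m)"
  using assms(2)
proof (induction rule: frag_induction)
  case zero
  show ?case by (simp add: ZX_upto_def)
qed (simp_all add: frag_extend_diff assms(1) ZX_upto_diff)

lemma basis_elem_closed:
  assumes "p \<in> basis_index m"
  shows "basis_elem p \<in> carrier (ZX_upto m)"
proof -
  obtain s c where p: "p = (s, c)" by (cases p)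
  have mon: "mon w \<in> carrier (ZX_upto m)" if "set w \<subseteq> {..<m}" for w
    using that by (simp add: ZX_upto_def words_below_def)
  have "mon s \<in> carrier (ZX_upto m)"
    using assms by (intro mon) (simp add: p basis_index_def)
  moreover have "pval c \<in> carrier (ZX_upto m)"
    using assms unfolding p basis_index_def
    by (cases c) (auto simp: pval_expand simp del: pval.simps intro!: mon ZX_upto_diff ZX_upto_add)
  ultimately show ?thesis
    using subringE(6)[OF subring_ZX_upto[of m], of "mon s" "pval c"]
    by (simp add: p basis_elem_def ring_of_type_algebra_def)
qed

text \<open>
  The map that sends a formal combination of indices to its coset is surjective because the family
  spans modulo \<open>I\<close>, and injective because it is independent modulo \<open>I\<close>.
\<close>

lemma free_abelian_quotient:
  fixes b :: "'i \<Rightarrow> free_ring"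
  assumes I: "ideal I (ZX_upto m)"
    and closed: "\<And>p. p \<in> B \<Longrightarrow> b p \<in> carrier (ZX_upto m)"
    and spans: "\<And>f. f \<in> carrier (ZX_upto m) \<Longrightarrow>
      \<exists>x. Poly_Mapping.keys x \<subseteq> B \<and> f - frag_extend b x \<in> I"
    and indep: "\<And>x. Poly_Mapping.keys x \<subseteq> B \<Longrightarrow> frag_extend b x \<in> I \<Longrightarrow> x = 0"
  shows "free_abelian (add_monoid (ZX_upto m Quot I))"
proof -
  interpret I: ideal I "ZX_upto m" by (rule I)
  have ops: "x \<oplus>\<^bsub>ZX_upto m\<^esub> y = x + y" for x y
    by (simp add: ZX_upto_def ring_of_type_algebra_def)
  have zero: "\<zero>\<^bsub>ZX_upto m\<^esub> = 0"
    by (simp add: ZX_upto_def ring_of_type_algebra_def)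
  have minus: "f \<ominus>\<^bsub>ZX_upto m\<^esub> g = f - g"
    if "f \<in> carrier (ZX_upto m)" "g \<in> carrier (ZX_upto m)" for f g
  proof -
    have "\<ominus>\<^bsub>ZX_upto m\<^esub> g = - g"
      using ZX_upto_diff[OF I.zero_closed that(2)] that(2)
      by (intro I.minus_equality) (simp_all add: ops zero)
    then show ?thesis by (simp add: a_minus_def ops)
  qed
  note ext = frag_extend_in_ZX_upto[of B b m, OF closed]
  define \<theta> where "\<theta> x = I +>\<^bsub>ZX_upto m\<^esub> frag_extend b x" for x
  have eq_iff: "I +>\<^bsub>ZX_upto m\<^esub> f = I +>\<^bsub>ZX_upto m\<^esub> g \<longleftrightarrow> f - g \<in> I"
    if "f \<in> carrier (ZX_upto m)" "g \<in> carrier (ZX_upto m)" for f g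
    using I.quotient_eq_iff_same_a_r_cos[OF I that] minus[OF that] by simp
  have carrier: "carrier (ZX_upto m Quot I) = {I +>\<^bsub>ZX_upto m\<^esub> f |f. f \<in> carrier (ZX_upto m)}"
    by (auto simp: FactRing_def A_RCOSETS_def')
  have inj: "inj_on \<theta> (carrier (free_Abelian_group B))"
  proof (rule inj_onI)
    fix x y assume xy: "x \<in> carrier (free_Abelian_group B)" "y \<in> carrier (free_Abelian_group B)" "\<theta> x = \<theta> y"
    then have "frag_extend b (x - y) \<in> I"
      using eq_iff[OF ext[of x] ext[of y]] by (simp add: \<theta>_def frag_extend_diff)
    moreover have "Poly_Mapping.keys (x - y) \<subseteq> B" using xy keys_diff[of x y] by auto
    ultimately show "x = y" using indep[of "x - y"] by simp
  qed
  have "\<theta> \<in> iso (free_Abelian_group B) (add_monoid (ZX_upto m Quot I))"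
  proof (rule isoI)
    show "\<theta> \<in> hom (free_Abelian_group B) (add_monoid (ZX_upto m Quot I))"
    proof (rule homI)
      fix x y assume "x \<in> carrier (free_Abelian_group B)" "y \<in> carrier (free_Abelian_group B)"
      then show "\<theta> (x \<otimes>\<^bsub>free_Abelian_group B\<^esub> y) = \<theta> x \<otimes>\<^bsub>add_monoid (ZX_upto m Quot I)\<^esub> \<theta> y"
        using ring_hom_add[OF I.rcos_ring_hom ext[of x] ext[of y]]
        by (simp add: \<theta>_def frag_extend_add ops)
    qed (use ext in \<open>auto simp: carrier \<theta>_def\<close>)
    have "\<theta> ` carrier (free_Abelian_group B) = carrier (ZX_upto m Quot I)"
    proof (intro equalityI subsetI)
      fix K assume "K \<in> carrier (ZX_upto m Quot I)"
      then obtain f where f: "f \<in> carrier (ZX_upto m)" "K = I +>\<^bsub>ZX_upto m\<^esub> f"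
        by (auto simp: carrier)
      then obtain x where "Poly_Mapping.keys x \<subseteq> B" "f - frag_extend b x \<in> I"
        using spans by blast
      then have "K = \<theta> x" "x \<in> carrier (free_Abelian_group B)"
        using eq_iff[OF f(1) ext[of x]] f(2) by (simp_all add: \<theta>_def)
      then show "K \<in> \<theta> ` carrier (free_Abelian_group B)" by blast
    qed (use ext in \<open>auto simp: carrier \<theta>_def\<close>)
    then show "bij_betw \<theta> (carrier (free_Abelian_group B)) (carrier (add_monoid (ZX_upto m Quot I)))"
      using inj by (simp add: bij_betw_def)
  qed
  then have iso: "add_monoid (ZX_upto m Quot I) \<cong> free_Abelian_group B"
    using group.iso_sym[OF group_free_Abelian_group] by (auto simp: is_iso_def)
  \<comment> \<open>The definition of a free abelian group asks for a basis inside the type of cosets.\<close>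
  have "inj_on (\<lambda>p. \<theta> (frag_of p)) B"
  proof (rule inj_onI)
    fix p q assume "p \<in> B" "q \<in> B" "\<theta> (frag_of p) = \<theta> (frag_of q)"
    then have "frag_of p = frag_of q" by (intro inj_onD[OF inj]) simp_all
    then show "p = q" by (simp only: frag_of_eq)
  qed
  then have "B \<approx> (\<lambda>p. \<theta> (frag_of p)) ` B"
    by (auto simp: eqpoll_def bij_betw_def)
  then have "free_Abelian_group B \<cong> free_Abelian_group ((\<lambda>p. \<theta> (frag_of p)) ` B)"
    by (simp add: isomorphic_free_Abelian_groups)
  then show ?thesis
    using iso_trans[OF iso] unfolding free_abelian_def by blast
qed

theorem proposition1p4:
  shows "(\<forall>m \<in> {2, 3, 4}. T4_upto m = T32_upto m) \<and>
         (\<forall>m. 1 \<le> m \<and> m \<le> 4 \<longrightarrow> free_abelian (add_monoid (ZX_upto m Quot T4_upto m)))"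
proof (intro conjI ballI allI impI)
  show "T4_upto m = T32_upto m" if "m \<in> {2, 3, 4}" for m
    using that by (intro T4_upto_eq_T32_upto) auto
  fix m :: nat assume "1 \<le> m \<and> m \<le> 4"
  then interpret lie32_few T32 m by unfold_locales simp
  show "free_abelian (add_monoid (ZX_upto m Quot T4_upto m))"
  proof (rule free_abelian_quotient[OF ideal_T4_upto basis_elem_closed])
    show "\<exists>x. Poly_Mapping.keys x \<subseteq> basis_index m \<and> f - frag_extend basis_elem x \<in> T4_upto m"
      if f: "f \<in> carrier (ZX_upto m)" for f
    proof -
      obtain x where x: "Poly_Mapping.keys x \<subseteq> basis_index m" "f - frag_extend basis_elem x \<in> T32"
        using basis_spans[OF f] by blast
      moreover have "f - frag_extend basis_elem x \<in> carrier (ZX_upto m)"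
        using frag_extend_in_ZX_upto[OF basis_elem_closed x(1)] by (rule ZX_upto_diff[OF f])
      ultimately show ?thesis
        using T4_upto_eq_T32_upto[OF m_le] by (auto simp: T32_upto_def)
    qed
    show "x = 0" if "Poly_Mapping.keys x \<subseteq> basis_index m" "frag_extend basis_elem x \<in> T4_upto m" for x
      using basis_independent[of x m] that T4_subset_T32 by (auto simp: T4_upto_def)
  qed
qed

end
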